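(* Let $m\ge2$ be an integer and set $\gamma=\frac1{m-1}$. For $k\in\{1,\dots,m\}$ let $\mathbf T_k\in\mathbb R^{m\times m}$ be given by $$(\mathbf T_k)_{i,j}=\begin{cases}\gamma,&\text{if } i=k\text{ and } j\ne k;\\1,&\text{if } i\ne k\text{ and } j=i;\\0,&\text{otherwise,}\end{cases}$$ and let $\mathbf T=\mathbf T_m\mathbf T_{m-1}\cdots\mathbf T_1$. Define $\widetilde{\mathbf T}\in\mathbb R^{m\times m}$ entrywise by $$\widetilde{\mathbf T}_{i,j}=\begin{cases}\gamma(1+\gamma)^{i-1},&\text{if } i<j;\\ \gamma(1+\gamma)^{i-1}-\gamma(1+\gamma)^{i-j},&\text{if } i\ge j.\end{cases}$$ Then for every $k\in\{1,\dots,m\}$ and all $i,j\in\{1,\dots,m\}$, $$\big(\mathbf T_k\mathbf T_{k-1}\cdots\mathbf T_1\big)_{i,j}=\begin{cases}\widetilde{\mathbf T}_{i,j},&\text{if }1\le i\le k;\\1,&\text{if }k+1\le i\le m\text{ and } j=i;\\0,&\text{if }k+1\le i\le m\text{ and } j\ne i.\end{cases}$$ In particular, $\mathbf T=\widetilde{\mathbf T}$.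
   Context: Rows and columns of matrices are indexed by $1,\dots,m$. *)

theory Defs
  imports Complex_Main "Jordan_Normal_Form.Matrix"
begin

text \<open>
  Matrices of the library are indexed from 0. The two definitions below translate to the
  convention that rows and columns are indexed by \<open>1, \<dots>, m\<close>; \<open>entry1\<close> is only meaningful
  for indices that are at least 1.
\<close>

definition mat1 :: "nat \<Rightarrow> (nat \<Rightarrow> nat \<Rightarrow> 'a) \<Rightarrow> 'a mat" where
  "mat1 m f = mat m m (\<lambda>(r, c). f (r + 1) (c + 1))"

definition entry1 :: "'a mat \<Rightarrow> nat \<Rightarrow> nat \<Rightarrow> 'a" where
  "entry1 A i j = A $$ (i - 1, j - 1)"

definition gam :: "nat \<Rightarrow> real" where
  "gam m = 1 / (real m - 1)"

definition T_step :: "nat \<Rightarrow> nat \<Rightarrow> real mat" where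
  "T_step m k = mat1 m (\<lambda>i j.
     if i = k \<and> j \<noteq> k then gam m
     else if i \<noteq> k \<and> j = i then 1
     else 0)"

text \<open>The product \<open>T\<^sub>k T\<^sub>k\<^sub>-\<^sub>1 \<cdots> T\<^sub>1\<close>, with the largest index leftmost.\<close>

fun T_prod :: "nat \<Rightarrow> nat \<Rightarrow> real mat" where
  "T_prod m 0 = 1\<^sub>m m"
| "T_prod m (Suc k) = T_step m (Suc k) * T_prod m k"

definition T_full :: "nat \<Rightarrow> real mat" where
  "T_full m = T_prod m m"

definition T_tilde :: "nat \<Rightarrow> real mat" where
  "T_tilde m = mat1 m (\<lambda>i j.
     if i < j then gam m * (1 + gam m) ^ (i - 1)
     else gam m * (1 + gam m) ^ (i - 1) - gam m * (1 + gam m) ^ (i - j))"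

end

theory Submission imports Defs begin

text \<open>
  Write \<open>\<gamma>\<close> for \<open>gam m\<close> and \<open>P\<^sub>k\<close> for the partial product \<open>T\<^sub>k \<cdots> T\<^sub>1\<close>. Multiplying by \<open>T\<^sub>k\<close> from the
  left leaves every row but the \<open>k\<close>-th alone, and replaces the \<open>k\<close>-th row by \<open>\<gamma>\<close> times the sum of
  all the other rows (\<open>entry1_T_prod_Suc\<close>). So each row is rewritten exactly once: in \<open>P\<^sub>k\<close> the rows
  \<open>1, \<dots>, k\<close> have their final values, and the rows below are still those of the identity matrix.

  By induction on \<open>k\<close>, the row \<open>k + 1\<close> of \<open>P\<^sub>k\<^sub>+\<^sub>1\<close> has \<open>j\<close>-th entry \<open>\<gamma>\<close> times the sum of the first \<open>k\<close>
  entries of column \<open>j\<close> of \<open>T_tilde m\<close>, plus \<open>\<gamma>\<close> if \<open>j > k + 1\<close>, when column \<open>j\<close> still contributes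
  its diagonal entry 1. The partial column sum is geometric (\<open>sum_T_tilde_col\<close>): the terms
  \<open>\<gamma>(1 + \<gamma>)\<^sup>i\<^sup>-\<^sup>1\<close> add up to \<open>(1 + \<gamma>)\<^sup>k - 1\<close>, and once row \<open>j\<close> is reached the subtracted terms
  \<open>\<gamma>(1 + \<gamma>)\<^sup>i\<^sup>-\<^sup>j\<close> add up to \<open>(1 + \<gamma>)\<^sup>k\<^sup>+\<^sup>1\<^sup>-\<^sup>j - 1\<close>. The total,
  diagonal entry included, is \<open>(1 + \<gamma>)\<^sup>k\<close> if \<open>j > k + 1\<close>, because the diagonal entry makes up for
  the \<open>-1\<close>, and \<open>(1 + \<gamma>)\<^sup>k - (1 + \<gamma>)\<^sup>k\<^sup>+\<^sup>1\<^sup>-\<^sup>j\<close> if \<open>j \<le> k + 1\<close>, where the \<open>-1\<close> left over at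
  \<open>j = k + 1\<close> is the power with exponent 0. Times \<open>\<gamma>\<close>, this is row \<open>k + 1\<close> of \<open>T_tilde m\<close>.
\<close>

lemma entry1_mat1:
  assumes "i \<in> {1..m}" "j \<in> {1..m}"
  shows "entry1 (mat1 m f) i j = f i j"
  using assms by (auto simp: entry1_def mat1_def)

lemma entry1_mult:
  fixes A B :: "'a :: semiring_0 mat"
  assumes "A \<in> carrier_mat m m" "B \<in> carrier_mat m m" "i \<in> {1..m}" "j \<in> {1..m}"
  shows "entry1 (A * B) i j = (\<Sum>l=1..m. entry1 A i l * entry1 B l j)"
proof -
  have "entry1 (A * B) i j = (\<Sum>l=0..<m. A $$ (i - 1, l) * B $$ (l, j - 1))"
    using assms by (auto simp: entry1_def scalar_prod_def intro!: sum.cong)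
  also have "\<dots> = (\<Sum>l=1..m. entry1 A i l * entry1 B l j)"
    by (rule sum.reindex_bij_witness[of _ "\<lambda>l. l - 1" Suc]) (auto simp: entry1_def)
  finally show ?thesis .
qed

lemma eq_mat_entry1I:
  assumes "A \<in> carrier_mat m m" "B \<in> carrier_mat m m"
    and "\<And>i j. i \<in> {1..m} \<Longrightarrow> j \<in> {1..m} \<Longrightarrow> entry1 A i j = entry1 B i j"
  shows "A = B"
proof (rule eq_matI)
  fix r c assume "r < dim_row B" "c < dim_col B"
  then show "A $$ (r, c) = B $$ (r, c)"
    using assms(2) assms(3)[of "Suc r" "Suc c"] by (auto simp: entry1_def)
qed (use assms(1,2) in auto)

lemma T_step_carrier: "T_step m k \<in> carrier_mat m m"
  by (simp add: T_step_def mat1_def)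

lemma T_tilde_carrier: "T_tilde m \<in> carrier_mat m m"
  by (simp add: T_tilde_def mat1_def)

lemma T_prod_carrier: "T_prod m k \<in> carrier_mat m m"
  by (induction k) (auto intro: mult_carrier_mat T_step_carrier)

lemma entry1_T_step:
  assumes "i \<in> {1..m}" "j \<in> {1..m}"
  shows "entry1 (T_step m k) i j =
    (if i = k \<and> j \<noteq> k then gam m else if i \<noteq> k \<and> j = i then 1 else 0)"
  unfolding T_step_def by (rule entry1_mat1[OF assms])

lemma entry1_T_tilde:
  assumes "i \<in> {1..m}" "j \<in> {1..m}"
  shows "entry1 (T_tilde m) i j =
    (if i < j then gam m * (1 + gam m) ^ (i - 1)
     else gam m * (1 + gam m) ^ (i - 1) - gam m * (1 + gam m) ^ (i - j))"
  unfolding T_tilde_def by (rule entry1_mat1[OF assms])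

text \<open>
  Off row \<open>k\<close>, the matrix \<open>T\<^sub>k\<close> agrees with the identity; its row \<open>k\<close> is constant except for the
  zero on the diagonal, so row \<open>k\<close> of the old matrix is discarded.
\<close>

lemma entry1_T_prod_Suc:
  assumes ij: "i \<in> {1..m}" "j \<in> {1..m}"
  shows "entry1 (T_prod m (Suc k)) i j =
    (if i = Suc k then gam m * (\<Sum>l\<in>{1..m} - {Suc k}. entry1 (T_prod m k) l j)
     else entry1 (T_prod m k) i j)"
proof -
  let ?P = "\<lambda>l. entry1 (T_prod m k) l j"
  have prod: "entry1 (T_prod m (Suc k)) i j = (\<Sum>l=1..m. entry1 (T_step m (Suc k)) i l * ?P l)"
    unfolding T_prod.simps by (rule entry1_mult[OF T_step_carrier T_prod_carrier ij])
  show ?thesis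
  proof (cases "i = Suc k")
    case True
    have "(\<Sum>l=1..m. entry1 (T_step m (Suc k)) i l * ?P l)
        = (\<Sum>l\<in>{1..m} - {Suc k}. gam m * ?P l)"
      using ij True by (intro sum.mono_neutral_cong_right) (auto simp: entry1_T_step)
    then show ?thesis
      using True prod by (simp add: sum_distrib_left)
  next
    case False
    have "(\<Sum>l=1..m. entry1 (T_step m (Suc k)) i l * ?P l) = (\<Sum>l\<in>{i}. ?P l)"
      using ij False by (intro sum.mono_neutral_cong_right) (auto simp: entry1_T_step)
    then show ?thesis
      using False prod by simp
  qed
qed

text \<open>
  The sum telescopes, since \<open>\<gamma>(1 + \<gamma>)\<^sup>n = (1 + \<gamma>)\<^sup>n\<^sup>+\<^sup>1 - (1 + \<gamma>)\<^sup>n\<close>. At \<open>n + 1 = j\<close> the two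
  formulas on the right-hand side coincide, so either of them can serve as the boundary case.
\<close>

lemma sum_T_tilde_col:
  assumes "n \<le> m" "j \<in> {1..m}"
  shows "(\<Sum>l=1..n. entry1 (T_tilde m) l j) =
    (if n < j then (1 + gam m) ^ n - 1 else (1 + gam m) ^ n - (1 + gam m) ^ (n + 1 - j))"
  using assms(1)
proof (induction n)
  case 0
  then show ?case using assms(2) by simp
next
  case (Suc n)
  let ?q = "1 + gam m"
  have IH: "(\<Sum>l=1..Suc n. entry1 (T_tilde m) l j) =
      (if n < j then ?q ^ n - 1 else ?q ^ n - ?q ^ (n + 1 - j)) + entry1 (T_tilde m) (Suc n) j"
    using Suc by simp
  have row: "entry1 (T_tilde m) (Suc n) j =
      (if Suc n < j then gam m * ?q ^ n else gam m * ?q ^ n - gam m * ?q ^ (Suc n - j))"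
    using entry1_T_tilde[of "Suc n" m j] Suc.prems assms(2) by simp
  consider "Suc n < j" | "Suc n = j" | "j \<le> n" by linarith
  then show ?case
  proof cases
    case 3
    then have "Suc n + 1 - j = Suc (n + 1 - j)" by simp
    with 3 show ?thesis unfolding IH row by (simp add: algebra_simps)
  qed (unfold IH row, auto simp: algebra_simps)
qed

text \<open>
  The induction starts from the identity matrix at \<open>k = 0\<close>. In its step only row \<open>k + 1\<close> changes;
  the hypothesis splits the sum of the other rows into a partial column sum of \<open>T_tilde m\<close> above
  that row and a column of the identity matrix below it.
\<close>

lemma entry1_T_prod:
  assumes "k \<le> m" "i \<in> {1..m}" "j \<in> {1..m}"
  shows "entry1 (T_prod m k) i j =
    (if i \<le> k then entry1 (T_tilde m) i j else if j = i then 1 else 0)"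
  using assms
proof (induction k arbitrary: i)
  case 0
  then show ?case by (auto simp: entry1_def)
next
  case (Suc k)
  let ?q = "1 + gam m" and ?P = "\<lambda>l. entry1 (T_prod m k) l j"
  have j: "j \<in> {1..m}" and k: "Suc k \<le> m" using Suc.prems by auto
  have IH: "?P l = (if l \<le> k then entry1 (T_tilde m) l j else if j = l then 1 else 0)"
    if "l \<in> {1..m}" for l
    using Suc.IH[OF _ that j] k by simp
  show ?case
  proof (cases "i = Suc k")
    case False
    then show ?thesis
      using IH[OF Suc.prems(2)] entry1_T_prod_Suc[OF Suc.prems(2) j, of k] by auto
  next
    case True
    have split: "{1..m} - {Suc k} = {1..k} \<union> {k+2..m}"
      using k by auto
    have "(\<Sum>l\<in>{1..m} - {Suc k}. ?P l) = (\<Sum>l=1..k. ?P l) + (\<Sum>l=k+2..m. ?P l)"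
      unfolding split by (rule sum.union_disjoint) auto
    also have "(\<Sum>l=1..k. ?P l) = (\<Sum>l=1..k. entry1 (T_tilde m) l j)"
      using k by (intro sum.cong) (auto simp: IH)
    also have "(\<Sum>l=k+2..m. ?P l) = (\<Sum>l=k+2..m. if j = l then 1 else 0)"
      by (intro sum.cong) (auto simp: IH)
    also have "\<dots> = (if Suc k < j then 1 else 0)"
      using j by (simp add: sum.delta')
    finally have others: "(\<Sum>l\<in>{1..m} - {Suc k}. ?P l) =
        (if k < j then ?q ^ k - 1 else ?q ^ k - ?q ^ (k + 1 - j)) + (if Suc k < j then 1 else 0)"
      using sum_T_tilde_col[of k m j] k j by simp
    have "entry1 (T_prod m (Suc k)) i j = gam m * (\<Sum>l\<in>{1..m} - {Suc k}. ?P l)"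
      using entry1_T_prod_Suc[OF Suc.prems(2) j, of k] True by simp
    also have "\<dots> = entry1 (T_tilde m) (Suc k) j"
    proof -
      consider "Suc k < j" | "Suc k = j" | "j \<le> k" by linarith
      then show ?thesis
        unfolding others using entry1_T_tilde[of "Suc k" m j] k j
        by cases (auto simp: algebra_simps)
    qed
    finally show ?thesis using True by simp
  qed
qed

theorem proposition4p1:
  fixes m :: nat
  assumes "m \<ge> 2"
  shows "(\<forall>k\<in>{1..m}. \<forall>i\<in>{1..m}. \<forall>j\<in>{1..m}.
            entry1 (T_prod m k) i j =
              (if i \<le> k then entry1 (T_tilde m) i j
               else if j = i then 1
               else 0))
         \<and> T_full m = T_tilde m"
proof
  show "\<forall>k\<in>{1..m}. \<forall>i\<in>{1..m}. \<forall>j\<in>{1..m}. entry1 (T_prod m k) i j =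
      (if i \<le> k then entry1 (T_tilde m) i j else if j = i then 1 else 0)"
    using entry1_T_prod by simp
  show "T_full m = T_tilde m"
    unfolding T_full_def
    by (rule eq_mat_entry1I[OF T_prod_carrier T_tilde_carrier]) (simp add: entry1_T_prod)
qed

end
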